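(* Consider the system (UNF) $\dot{x}=y,\ \dot{y}=-(x^2+z-1)x-\lambda y,\ \dot{z}=-\alpha z+\beta x^2$ with positive parameters $\lambda,\alpha,\beta$, and put $A=\dfrac{\alpha+\beta}{2}$. With the correspondence between generalized Lorenz systems and UNF parameters described in the context: (1) The parameter region $\lambda>A$ of UNF corresponds to the generalized Lorenz systems with $q>0$ (the Lorenz-like systems). (2) The parameter region $\lambda<A$ of UNF corresponds to the generalized Lorenz systems with $q<0$ (the Chen-like systems), such that for $\lambda=\dfrac{A^2-1}{2A}<A$ the UNF corresponds to the original Chen system. (3) The parameter set $\lambda=\dfrac{A^2-1}{A}<A$ of UNF corresponds to the Lu system. (4) The dividing line $\lambda=A$ corresponds to the Tigan system.
   Context: The generalized Lorenz system is $\dot x=-a(x-y),\ \dot y=(r-z)x-qy,\ \dot z=xy-bz$ with $a>0$, $b>0$, and $r>q>-a$. With $\omega=(a(r-q))^{-1/2}>0$, its associated UNF parameters are $\lambda=(q+a)\omega$, $\alpha=b\omega$, $\beta=(2a-b)\omega$ (the generalized Lorenz system is transformed into UNF with these parameters by a one-to-one change of variables and time). Then $A=a\omega$. A set of UNF parameter points $(\lambda,\alpha,\beta)$ with $\lambda,\alpha,\beta>0$ is said to correspond to a class of generalized Lorenz systems if it is the set of those positive parameter triples that are associated with systems of this class. Special classes of generalized Lorenz systems: Lorenz system: $r>0$, $q=1$; Chen system: $r=c-a$, $q=-c$, $c>0$; Lu system: $r=0$, $q=-c$, $c>0$; Tigan system: $r=c-a$, $q=0$ (with $c$ a real parameter).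 *)

theory Defs
  imports "HOL-Analysis.Analysis"
begin

text \<open>Systems of ordinary differential equations are represented by their vector fields.\<close>

type_synonym vfield = "real \<times> real \<times> real \<Rightarrow> real \<times> real \<times> real"

definition gen_lorenz :: "real \<Rightarrow> real \<Rightarrow> real \<Rightarrow> real \<Rightarrow> vfield" where
  "gen_lorenz a b r q = (\<lambda>(x, y, z). (- a * (x - y), (r - z) * x - q * y, x * y - b * z))"

definition admissible :: "real \<Rightarrow> real \<Rightarrow> real \<Rightarrow> real \<Rightarrow> bool" where
  "admissible a b r q \<longleftrightarrow> a > 0 \<and> b > 0 \<and> r > q \<and> q > - a"

definition unf :: "real \<Rightarrow> real \<Rightarrow> real \<Rightarrow> vfield" where
  "unf lam \<alpha> \<beta> = (\<lambda>(x, y, z). (y, - (x\<^sup>2 + z - 1) * x - lam * y, - \<alpha> * z + \<beta> * x\<^sup>2))"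

definition unf_scale :: "real \<Rightarrow> real \<Rightarrow> real \<Rightarrow> real" where
  "unf_scale a r q = (a * (r - q)) powr (- 1 / 2)"

definition unf_params :: "real \<Rightarrow> real \<Rightarrow> real \<Rightarrow> real \<Rightarrow> real \<times> real \<times> real" where
  "unf_params a b r q =
    (let \<omega> = unf_scale a r q in ((q + a) * \<omega>, b * \<omega>, (2 * a - b) * \<omega>))"

definition associated :: "vfield \<Rightarrow> real \<times> real \<times> real \<Rightarrow> bool" where
  "associated F p \<longleftrightarrow>
    (\<exists>a b r q. admissible a b r q \<and> F = gen_lorenz a b r q \<and> p = unf_params a b r q)"

text \<open>The change of variables (with time rescaled by the factor \<open>unf_scale a r q\<close>) that
  justifies \<open>unf_params\<close>; see \<open>gen_lorenz_to_unf\<close> below.\<close>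

definition unf_change :: "real \<Rightarrow> real \<Rightarrow> real \<Rightarrow> vfield" where
  "unf_change a r q = (let \<omega> = unf_scale a r q in
    (\<lambda>(x, y, z). (\<omega> * x / sqrt 2, a * \<omega>\<^sup>2 * (y - x) / sqrt 2, a * \<omega>\<^sup>2 * (z - x\<^sup>2 / (2 * a)))))"

lemma unf_scale_pos: "admissible a b r q \<Longrightarrow> unf_scale a r q > 0"
  by (simp add: admissible_def unf_scale_def)

lemma unf_scale_square:
  assumes "admissible a b r q"
  shows "a * (r - q) * (unf_scale a r q)\<^sup>2 = 1"
proof -
  have "a * (r - q) > 0" "a * (r - q) \<noteq> 0"
    using assms by (simp_all add: admissible_def)
  then show ?thesis
    by (simp add: unf_scale_def powr_minus powr_half_sqrt power_inverse right_inverse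
        del: inverse_mult_distrib mult_pos_pos zero_less_mult_iff)
qed

lemma bij_unf_change:
  assumes "admissible a b r q"
  shows "bij (unf_change a r q)"
proof -
  define \<omega> where "\<omega> = unf_scale a r q"
  have pos: "a > 0" "\<omega> > 0"
    using assms unf_scale_pos by (auto simp: admissible_def \<omega>_def)
  define g where "g = (\<lambda>(X, Y, Z). let x = sqrt 2 * X / \<omega> in
    (x, x + sqrt 2 * Y / (a * \<omega>\<^sup>2), Z / (a * \<omega>\<^sup>2) + x\<^sup>2 / (2 * a)))"
  have change: "unf_change a r q = (\<lambda>(x, y, z).
      (\<omega> * x / sqrt 2, a * \<omega>\<^sup>2 * (y - x) / sqrt 2, a * \<omega>\<^sup>2 * (z - x\<^sup>2 / (2 * a))))"
    by (simp add: unf_change_def \<omega>_def Let_def)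
  show ?thesis
    by (rule o_bij[of g]) (use pos in \<open>auto simp: fun_eq_iff g_def change Let_def\<close>)
qed

lemma gen_lorenz_to_unf:
  assumes adm: "admissible a b r q"
    and \<omega>: "\<omega> = unf_scale a r q"
    and par: "unf_params a b r q = (lam, \<alpha>, \<beta>)"
    and sol: "(u has_vector_derivative gen_lorenz a b r q (u (\<omega> * s))) (at (\<omega> * s))"
  shows "((\<lambda>s. unf_change a r q (u (\<omega> * s))) has_vector_derivative
    unf lam \<alpha> \<beta> (unf_change a r q (u (\<omega> * s)))) (at s)"
proof -
  have a: "a > 0" and w: "\<omega> > 0"
    using adm unf_scale_pos \<omega> by (auto simp: admissible_def)
  have sq: "a * (r - q) * \<omega>\<^sup>2 = 1"
    using unf_scale_square[OF adm] \<omega> by simp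
  have p: "lam = (q + a) * \<omega>" "\<alpha> = b * \<omega>" "\<beta> = (2 * a - b) * \<omega>"
    using par \<omega> by (auto simp: unf_params_def Let_def)
  define x y z where "x = (\<lambda>s. fst (u (\<omega> * s)))" and "y = (\<lambda>s. fst (snd (u (\<omega> * s))))"
    and "z = (\<lambda>s. snd (snd (u (\<omega> * s))))"
  have u: "u (\<omega> * s) = (x s, y s, z s)" for s
    by (simp add: x_def y_def z_def)
  have "((\<lambda>s. \<omega> * s) has_vector_derivative \<omega>) (at s)"
    by (auto intro!: derivative_eq_intros)
  from vector_diff_chain_at[OF this sol]
  have D: "((\<lambda>s. u (\<omega> * s)) has_vector_derivative
      \<omega> *\<^sub>R gen_lorenz a b r q (x s, y s, z s)) (at s)"
    by (simp add: o_def u)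
  note fs = bounded_linear.has_vector_derivative[OF bounded_linear_fst]
  note sn = bounded_linear.has_vector_derivative[OF bounded_linear_snd]
  have dx: "(x has_real_derivative \<omega> * (- a * (x s - y s))) (at s)"
    using fs[OF D] by (simp add: x_def gen_lorenz_def has_real_derivative_iff_has_vector_derivative)
  have dy: "(y has_real_derivative \<omega> * ((r - z s) * x s - q * y s)) (at s)"
    using fs[OF sn[OF D]]
    by (simp add: y_def gen_lorenz_def has_real_derivative_iff_has_vector_derivative)
  have dz: "(z has_real_derivative \<omega> * (x s * y s - b * z s)) (at s)"
    using sn[OF sn[OF D]]
    by (simp add: z_def gen_lorenz_def has_real_derivative_iff_has_vector_derivative)
  define X Y Z where "X = (\<lambda>s. \<omega> * x s / sqrt 2)" and "Y = (\<lambda>s. a * \<omega>\<^sup>2 * (y s - x s) / sqrt 2)"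
    and "Z = (\<lambda>s. a * \<omega>\<^sup>2 * (z s - (x s)\<^sup>2 / (2 * a)))"
  have XX: "(X s)\<^sup>2 = \<omega>\<^sup>2 * (x s)\<^sup>2 / 2"
    by (simp add: X_def power_mult_distrib power_divide)
  have dX: "(X has_real_derivative Y s) (at s)"
    unfolding X_def Y_def
    by (auto intro!: derivative_eq_intros dx simp: field_simps power2_eq_square)
  have "(Y has_real_derivative a * \<omega>\<^sup>2 * (\<omega> * ((r - z s) * x s - q * y s)
      - \<omega> * (- a * (x s - y s))) / sqrt 2) (at s)"
    unfolding Y_def by (intro DERIV_cdivide DERIV_cmult DERIV_diff dx dy)
  moreover have "a * \<omega>\<^sup>2 * (\<omega> * ((r - z s) * x s - q * y s) - \<omega> * (- a * (x s - y s))) / sqrt 2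
      = - ((X s)\<^sup>2 + Z s - 1) * X s - lam * Y s"
  proof -
    have "(X s)\<^sup>2 + Z s = a * \<omega>\<^sup>2 * z s"
      unfolding XX Z_def using a by (simp add: field_simps)
    then have e: "(X s)\<^sup>2 + Z s - 1 = a * \<omega>\<^sup>2 * z s - a * (r - q) * \<omega>\<^sup>2"
      using sq by simp
    show ?thesis
      unfolding e unfolding X_def Y_def p by (simp add: field_simps power2_eq_square)
  qed
  ultimately have dY: "(Y has_real_derivative - ((X s)\<^sup>2 + Z s - 1) * X s - lam * Y s) (at s)"
    by simp
  have "(Z has_real_derivative a * \<omega>\<^sup>2 * (\<omega> * (x s * y s - b * z s)
      - 2 * x s * (\<omega> * (- a * (x s - y s))) / (2 * a))) (at s)"
    unfolding Z_def using a by (auto intro!: derivative_eq_intros dx dz)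
  moreover have "a * \<omega>\<^sup>2 * (\<omega> * (x s * y s - b * z s) - 2 * x s * (\<omega> * (- a * (x s - y s))) / (2 * a))
      = - \<alpha> * Z s + \<beta> * (X s)\<^sup>2"
    unfolding XX Z_def p using a by (simp add: field_simps power2_eq_square)
  ultimately have dZ: "(Z has_real_derivative - \<alpha> * Z s + \<beta> * (X s)\<^sup>2) (at s)"
    by simp
  have eq: "unf_change a r q (u (\<omega> * s)) = (X s, Y s, Z s)" for s
    by (simp add: u unf_change_def \<omega>[symmetric] Let_def X_def Y_def Z_def)
  show ?thesis
    unfolding eq unf_def prod.case
    by (intro has_vector_derivative_Pair dX[unfolded has_real_derivative_iff_has_vector_derivative]
        dY[unfolded has_real_derivative_iff_has_vector_derivative]
        dZ[unfolded has_real_derivative_iff_has_vector_derivative])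
qed

definition corresponds :: "(real \<times> real \<times> real) set \<Rightarrow> vfield set \<Rightarrow> bool" where
  "corresponds S C \<longleftrightarrow>
    S = {(lam, \<alpha>, \<beta>). lam > 0 \<and> \<alpha> > 0 \<and> \<beta> > 0 \<and> (\<exists>F\<in>C. associated F (lam, \<alpha>, \<beta>))}"

definition unf_region :: "(real \<Rightarrow> real \<Rightarrow> bool) \<Rightarrow> (real \<times> real \<times> real) set" where
  "unf_region P = {(lam, \<alpha>, \<beta>). lam > 0 \<and> \<alpha> > 0 \<and> \<beta> > 0 \<and> P lam ((\<alpha> + \<beta>) / 2)}"

definition lorenz_like_systems :: "vfield set" where
  "lorenz_like_systems = {gen_lorenz a b r q | a b r q. admissible a b r q \<and> q > 0}"

definition chen_like_systems :: "vfield set" where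
  "chen_like_systems = {gen_lorenz a b r q | a b r q. admissible a b r q \<and> q < 0}"

definition chen_systems :: "vfield set" where
  "chen_systems =
    {gen_lorenz a b r q | a b r q c. admissible a b r q \<and> r = c - a \<and> q = - c \<and> c > 0}"

definition lu_systems :: "vfield set" where
  "lu_systems =
    {gen_lorenz a b r q | a b r q c. admissible a b r q \<and> r = 0 \<and> q = - c \<and> c > 0}"

definition tigan_systems :: "vfield set" where
  "tigan_systems =
    {gen_lorenz a b r q | a b r q c. admissible a b r q \<and> r = c - a \<and> q = 0}"

end

theory Submission
  imports Defs
begin

text \<open>With \<open>\<omega> = unf_scale a r q\<close> one has \<open>A = a \<omega>\<close> and \<open>\<lambda> = (q + a) \<omega>\<close>, so the sign of
  \<open>\<lambda> - A\<close> is the sign of \<open>q\<close>; since \<open>a (r - q) \<omega>\<^sup>2 = 1\<close>, the equation \<open>2 A \<lambda> = A\<^sup>2 - 1\<close> amounts to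
  \<open>r = - q - a\<close> and \<open>A \<lambda> = A\<^sup>2 - 1\<close> to \<open>r = 0\<close>. Every positive parameter triple already comes
  from a system with \<open>\<omega> = 1\<close>, and a vector field determines its parameters, so each
  correspondence reduces to such an equivalence.\<close>

lemma gen_lorenz_inject:
  "gen_lorenz a b r q = gen_lorenz a' b' r' q' \<longleftrightarrow> a = a' \<and> b = b' \<and> r = r' \<and> q = q'"
proof
  assume eq: "gen_lorenz a b r q = gen_lorenz a' b' r' q'"
  show "a = a' \<and> b = b' \<and> r = r' \<and> q = q'"
    \<comment> \<open>The first unit vector reveals \<open>a\<close> and \<open>r\<close>, the
      second \<open>q\<close>, and the third \<open>b\<close>.\<close>
    using fun_cong[OF eq, of "(1, 0, 0)"] fun_cong[OF eq, of "(0, 1, 0)"]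
      fun_cong[OF eq, of "(0, 0, 1)"]
    by (simp add: gen_lorenz_def)
qed simp

lemma associated_gen_lorenz:
  "associated (gen_lorenz a b r q) p \<longleftrightarrow> admissible a b r q \<and> p = unf_params a b r q"
  by (auto simp: associated_def gen_lorenz_inject)

lemma unf_params_surj:
  assumes "lam > 0" "\<alpha> > 0" "\<beta> > 0"
  obtains a b r q where "admissible a b r q" "unf_params a b r q = (lam, \<alpha>, \<beta>)"
proof -
  define A where "A = (\<alpha> + \<beta>) / 2"
  have "A > 0"
    using assms by (simp add: A_def)
  \<comment> \<open>Normalising the time scale to 1 forces \<open>a = A\<close>,
    \<open>b = \<alpha>\<close>, \<open>q = lam - A\<close> and \<open>a * (r - q) = 1\<close>, that
    is, \<open>r = q + 1 / A\<close>.\<close>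
  then have adm: "admissible A \<alpha> (lam - A + 1 / A) (lam - A)"
    using assms by (simp add: admissible_def)
  have "unf_scale A (lam - A + 1 / A) (lam - A) = 1"
    using \<open>A > 0\<close> by (simp add: unf_scale_def)
  then have "unf_params A \<alpha> (lam - A + 1 / A) (lam - A) = (lam, \<alpha>, \<beta>)"
    by (simp add: unf_params_def) (simp add: A_def field_simps)
  with adm show thesis ..
qed

text \<open>Reduces a correspondence to an algebraic equivalence. The scale enters only as a
  positive \<open>w\<close> with \<open>a * (r - q) * w^2 = 1\<close>, which hides the
  \<open>powr\<close> from the individual cases.\<close>

lemma corresponds_unf_regionI:
  assumes C: "\<And>F. F \<in> C \<longleftrightarrow> (\<exists>a b r q. F = gen_lorenz a b r q \<and> admissible a b r q \<and> P a r q)"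
    and P: "\<And>a b r q w. \<lbrakk>admissible a b r q; w > 0; a * (r - q) * w\<^sup>2 = 1\<rbrakk>
      \<Longrightarrow> P a r q \<longleftrightarrow> R ((q + a) * w) (a * w)"
  shows "corresponds (unf_region R) C"
proof -
  have P_iff: "P a r q \<longleftrightarrow> R lam ((\<alpha> + \<beta>) / 2)"
    if adm: "admissible a b r q" and par: "unf_params a b r q = (lam, \<alpha>, \<beta>)"
    for a b r q lam \<alpha> \<beta>
  proof -
    define w where "w = unf_scale a r q"
    \<comment> \<open>In the sum of \<open>b * w\<close> and \<open>(2 * a - b) * w\<close> the
      parameter \<open>b\<close> cancels.\<close>
    have "lam = (q + a) * w" and "(\<alpha> + \<beta>) / 2 = a * w"
      using par by (auto simp: unf_params_def w_def Let_def field_simps)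
    then show ?thesis
      using P[OF adm unf_scale_pos[OF adm] unf_scale_square[OF adm]] by (simp add: w_def)
  qed
  have "(\<exists>F\<in>C. associated F (lam, \<alpha>, \<beta>)) \<longleftrightarrow> R lam ((\<alpha> + \<beta>) / 2)"
    if pos: "lam > 0" "\<alpha> > 0" "\<beta> > 0" for lam \<alpha> \<beta>
  proof
    assume "\<exists>F\<in>C. associated F (lam, \<alpha>, \<beta>)"
    then obtain a b r q where "admissible a b r q" "P a r q" "unf_params a b r q = (lam, \<alpha>, \<beta>)"
      unfolding Bex_def C by (auto simp: associated_gen_lorenz)
    then show "R lam ((\<alpha> + \<beta>) / 2)"
      using P_iff by blast
  next
    assume R: "R lam ((\<alpha> + \<beta>) / 2)"
    \<comment> \<open>Any preimage of the triple will do, since \<open>P_iff\<close> holds for every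
      admissible system with these parameters.\<close>
    obtain a b r q where *: "admissible a b r q" "unf_params a b r q = (lam, \<alpha>, \<beta>)"
      using unf_params_surj[OF pos] .
    then have "gen_lorenz a b r q \<in> C"
      using R P_iff unfolding C by blast
    with * show "\<exists>F\<in>C. associated F (lam, \<alpha>, \<beta>)"
      by (metis associated_gen_lorenz)
  qed
  then show ?thesis
    unfolding corresponds_def unf_region_def by auto
qed

lemma corresponds_lorenz_like: "corresponds (unf_region (\<lambda>lam A. lam > A)) lorenz_like_systems"
  by (rule corresponds_unf_regionI[where P = "\<lambda>a r q. q > 0"])
    (auto simp: lorenz_like_systems_def distrib_right zero_less_mult_iff)

lemma corresponds_chen_like: "corresponds (unf_region (\<lambda>lam A. lam < A)) chen_like_systems"
  by (rule corresponds_unf_regionI[where P = "\<lambda>a r q. q < 0"])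
    (auto simp: chen_like_systems_def distrib_right mult_less_0_iff)

lemma corresponds_tigan: "corresponds (unf_region (\<lambda>lam A. lam = A)) tigan_systems"
proof (rule corresponds_unf_regionI[where P = "\<lambda>a r q. q = 0"])
  fix F
  show "F \<in> tigan_systems \<longleftrightarrow>
      (\<exists>a b r q. F = gen_lorenz a b r q \<and> admissible a b r q \<and> q = 0)"
    \<comment> \<open>As \<open>c\<close> is an arbitrary real, \<open>c = r + a\<close> always
      solves \<open>r = c - a\<close>.\<close>
    unfolding tigan_systems_def by simp (metis diff_add_cancel add_diff_cancel)
qed (simp add: distrib_right)

lemma corresponds_chen:
  "corresponds (unf_region (\<lambda>lam A. lam = (A\<^sup>2 - 1) / (2 * A) \<and> lam < A)) chen_systems"
proof (rule corresponds_unf_regionI[where P = "\<lambda>a r q. r = - q - a \<and> q < 0"])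
  fix F
  show "F \<in> chen_systems \<longleftrightarrow>
      (\<exists>a b r q. F = gen_lorenz a b r q \<and> admissible a b r q \<and> r = - q - a \<and> q < 0)"
    \<comment> \<open>Eliminate \<open>c = - q\<close>.\<close>
    unfolding chen_systems_def by simp (metis minus_minus neg_less_0_iff_less)
next
  fix a b r q w :: real
  assume adm: "admissible a b r q" and w: "w > 0" and sq: "a * (r - q) * w\<^sup>2 = 1"
  have a: "a > 0"
    using adm by (simp add: admissible_def)
  have "(q + a) * w = ((a * w)\<^sup>2 - 1) / (2 * (a * w))
      \<longleftrightarrow> (a * w\<^sup>2) * (r + q + a) = 0"
    \<comment> \<open>Replacing 1 by \<open>a * (r - q) * w^2\<close> makes the equation homogeneous
      in \<open>w\<close>; after clearing the denominator \<open>a * w^2\<close> factors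
      out.\<close>
    unfolding sq[symmetric] using a w by (simp add: field_simps power2_eq_square)
  also have "\<dots> \<longleftrightarrow> r = - q - a"
    using a w by auto
  finally show "r = - q - a \<and> q < 0 \<longleftrightarrow>
      (q + a) * w = ((a * w)\<^sup>2 - 1) / (2 * (a * w)) \<and> (q + a) * w < a * w"
    using w by (simp add: mult_less_cancel_right)
qed

lemma corresponds_lu:
  "corresponds (unf_region (\<lambda>lam A. lam = (A\<^sup>2 - 1) / A \<and> lam < A)) lu_systems"
proof (rule corresponds_unf_regionI[where P = "\<lambda>a r q. r = 0 \<and> q < 0"])
  fix F
  show "F \<in> lu_systems \<longleftrightarrow>
      (\<exists>a b r q. F = gen_lorenz a b r q \<and> admissible a b r q \<and> r = 0 \<and> q < 0)"
    unfolding lu_systems_def by simp (metis minus_minus neg_less_0_iff_less)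
next
  fix a b r q w :: real
  assume adm: "admissible a b r q" and w: "w > 0" and sq: "a * (r - q) * w\<^sup>2 = 1"
  have a: "a > 0"
    using adm by (simp add: admissible_def)
  have "(q + a) * w = ((a * w)\<^sup>2 - 1) / (a * w) \<longleftrightarrow> (a * w\<^sup>2) * r = 0"
    \<comment> \<open>The same substitution for 1; here \<open>q\<close> and \<open>a\<close> cancel
      in the remaining factor, leaving \<open>r\<close>.\<close>
    unfolding sq[symmetric] using a w by (simp add: field_simps power2_eq_square)
  also have "\<dots> \<longleftrightarrow> r = 0"
    using a w by auto
  finally show "r = 0 \<and> q < 0 \<longleftrightarrow>
      (q + a) * w = ((a * w)\<^sup>2 - 1) / (a * w) \<and> (q + a) * w < a * w"
    using w by (simp add: mult_less_cancel_right)
qed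

text \<open>The two curves are \<open>A / 2 - 1 / (2 * A)\<close> and
  \<open>A - 1 / A\<close>.\<close>

lemma chen_lu_curves_below_line:
  assumes "A > (0 :: real)"
  shows "(A\<^sup>2 - 1) / (2 * A) < A" "(A\<^sup>2 - 1) / A < A"
  using assms by (simp_all add: field_simps power2_eq_square add_pos_pos)

theorem proposition2:
  "corresponds (unf_region (\<lambda>lam A. lam > A)) lorenz_like_systems \<and>
   corresponds (unf_region (\<lambda>lam A. lam < A)) chen_like_systems \<and>
   corresponds (unf_region (\<lambda>lam A. lam = (A\<^sup>2 - 1) / (2 * A) \<and> lam < A)) chen_systems \<and>
   (\<forall>\<alpha> \<beta> A :: real. \<alpha> > 0 \<and> \<beta> > 0 \<and> A = (\<alpha> + \<beta>) / 2 \<longrightarrow> (A\<^sup>2 - 1) / (2 * A) < A) \<and>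
   corresponds (unf_region (\<lambda>lam A. lam = (A\<^sup>2 - 1) / A \<and> lam < A)) lu_systems \<and>
   (\<forall>\<alpha> \<beta> A :: real. \<alpha> > 0 \<and> \<beta> > 0 \<and> A = (\<alpha> + \<beta>) / 2 \<longrightarrow> (A\<^sup>2 - 1) / A < A) \<and>
   corresponds (unf_region (\<lambda>lam A. lam = A)) tigan_systems"
  by (intro conjI allI impI corresponds_lorenz_like corresponds_chen_like corresponds_chen
      corresponds_lu corresponds_tigan chen_lu_curves_below_line) auto

end
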